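(* Let $n\ge1$, $1\le r\le p$ be integers, $\delta\in(0,1)$, and let $\Sigma,\widetilde\Sigma\in\mathbb{R}^{p\times p}$ be positive definite covariance matrices. Let $Q$ be uniformly distributed on the Stiefel manifold $\mathbb{S}(p,r)$. Let $f_0,f_1,\tilde f_0,\tilde f_1$ be the joint densities of $\{X_i\}_{i=1}^n$ (with $X_i\in\mathbb{R}^p$) under the following respective models: $$f_0:\ X_i\stackrel{iid}{\sim}N(0,\Sigma);\qquad f_1:\ (X_i\mid Q)\stackrel{iid}{\sim}N\big(0,\Sigma+\tfrac{\delta}{1-\delta}QQ'\big);$$ $$\tilde f_0:\ X_i\stackrel{iid}{\sim}N(0,\widetilde\Sigma);\qquad \tilde f_1:\ (X_i\mid Q)\stackrel{iid}{\sim}N\big(0,\widetilde\Sigma+\tfrac{\delta}{1-\delta}QQ'\big).$$ If $\Sigma\preceq\widetilde\Sigma$, then $\|\tilde f_1-\tilde f_0\|_1\le\|f_1-f_0\|_1$.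
   Context: $\mathbb{S}(p,r)=\{Q\in\mathbb{R}^{p\times r}:Q'Q=I_r\}$ is the Stiefel manifold; "uniform" means the law invariant under left multiplication by orthogonal $p\times p$ matrices. $A\preceq B$ means $B-A$ is positive semidefinite. $\|f-g\|_1=\int|f(x)-g(x)|\,dx$. In the models conditional on $Q$, a single $Q$ is drawn, common to all $i$, and the joint density is the mixture over $Q$. *)

theory Defs
  imports "HOL-Probability.Probability"
begin

(* A p x r real matrix has type real^'r^'p with CARD('p) = p and CARD('r) = r.
   A sample of size n in R^p has type real^'p^'n, with x $ i the i-th observation. *)

definition pos_semidef :: "real^'p^'p \<Rightarrow> bool" where
  "pos_semidef A \<longleftrightarrow> transpose A = A \<and> (\<forall>v. 0 \<le> v \<bullet> (A *v v))"

definition pos_def :: "real^'p^'p \<Rightarrow> bool" where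
  "pos_def A \<longleftrightarrow> transpose A = A \<and> (\<forall>v. v \<noteq> 0 \<longrightarrow> 0 < v \<bullet> (A *v v))"

definition loewner_le :: "real^'p^'p \<Rightarrow> real^'p^'p \<Rightarrow> bool" (infix "\<preceq>" 50) where
  "A \<preceq> B \<longleftrightarrow> pos_semidef (B - A)"

definition stiefel :: "(real^'r^'p) set" where
  "stiefel = {Q. transpose Q ** Q = mat 1}"

(* The uniform law is taken as a Borel law on all p x r matrices that is carried by
   the Stiefel manifold, which is a closed set. *)
definition uniform_stiefel :: "(real^'r^'p) measure \<Rightarrow> bool" where
  "uniform_stiefel \<nu> \<longleftrightarrow> prob_space \<nu> \<and> sets \<nu> = sets borel \<and> emeasure \<nu> stiefel = 1 \<and>
     (\<forall>U :: real^'p^'p. orthogonal_matrix U \<longrightarrow> distr \<nu> borel (\<lambda>Q. U ** Q) = \<nu>)"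

(* Lebesgue density of N(m, S); meaningful only for positive definite S. *)
definition mvn_density :: "real^'p \<Rightarrow> real^'p^'p \<Rightarrow> real^'p \<Rightarrow> real" where
  "mvn_density m S x =
     exp (- ((x - m) \<bullet> (matrix_inv S *v (x - m))) / 2) / sqrt ((2 * pi) ^ CARD('p) * det S)"

definition iid_normal_density :: "real^'p^'p \<Rightarrow> real^'p^'n \<Rightarrow> real" where
  "iid_normal_density S x = (\<Prod>i\<in>UNIV. mvn_density 0 S (x $ i))"

(* One draw of Q is shared by all n observations, so the expectation over Q is taken
   outside the product over i. *)
definition spiked_density ::
    "'w measure \<Rightarrow> ('w \<Rightarrow> real^'r^'p) \<Rightarrow> real \<Rightarrow> real^'p^'p \<Rightarrow> real^'p^'n \<Rightarrow> real" where
  "spiked_density M Q \<delta> S x =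
     (LINT \<omega>|M. iid_normal_density (S + (\<delta> / (1 - \<delta>)) *\<^sub>R (Q \<omega> ** transpose (Q \<omega>))) x)"

definition l1_dist :: "('a::euclidean_space \<Rightarrow> real) \<Rightarrow> ('a \<Rightarrow> real) \<Rightarrow> real" where
  "l1_dist f g = (LINT x|lborel. \<bar>f x - g x\<bar>)"

end

theory Submission
  imports Defs
begin

text \<open>Adding independent \<open>N(0, \<Sigma>' - \<Sigma>)\<close> noise to every observation turns both models with
  covariance \<open>\<Sigma>\<close> into those with \<open>\<Sigma>'\<close>, and convolution with a probability measure contracts the
  \<open>L\<^sup>1\<close> norm. Since \<open>\<Sigma>' - \<Sigma>\<close> may be singular, it is split into outer products \<open>v v'\<close>, which are
  added to one observation at a time; each such step is a one-dimensional Gaussian integral, computed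
  with the Sherman--Morrison formula and the rank-one determinant formula. The same steps, started
  from \<open>\<epsilon> I \<preceq> \<Sigma>\<close>, show that all the densities involved are uniformly bounded and of bounded mass.\<close>

section \<open>Positive semidefinite matrices and rank-one updates\<close>

definition outer :: "real^'p \<Rightarrow> real^'p^'p" where
  "outer v = (\<chi> i j. v $ i * v $ j)"

lemma outer_mult: "outer v *v x = (v \<bullet> x) *\<^sub>R v"
  by (simp add: outer_def vec_eq_iff matrix_vector_mult_def inner_vec_def sum_distrib_left
      sum_distrib_right mult_ac)

lemma transpose_outer: "transpose (outer v) = outer v"
  by (simp add: outer_def vec_eq_iff transpose_def mult.commute)

lemma inner_symmetric_matrix:
  fixes A :: "real^'p^'p"
  assumes "transpose A = A"
  shows "x \<bullet> (A *v y) = y \<bullet> (A *v x)"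
  by (metis assms dot_lmul_matrix inner_commute transpose_matrix_vector)

lemma transpose_add: "transpose (A + B) = transpose A + transpose (B :: real^'p^'q)"
  by (simp add: transpose_def vec_eq_iff)

lemma transpose_diff: "transpose (A - B) = transpose A - transpose (B :: real^'p^'q)"
  by (simp add: transpose_def vec_eq_iff)

lemma transpose_scaleR: "transpose (c *\<^sub>R A) = c *\<^sub>R transpose (A :: real^'p^'q)"
  by (simp add: transpose_def vec_eq_iff)

lemma mat_mult: "(mat c :: real^'p^'p) *v x = c *\<^sub>R x"
proof -
  have "(mat c :: real^'p^'p) = c *\<^sub>R mat 1"
    by (simp add: vec_eq_iff mat_def)
  then show ?thesis
    by (simp add: scaleR_matrix_vector_assoc [symmetric])
qed

lemma pos_semidef_add: "pos_semidef A \<Longrightarrow> pos_semidef B \<Longrightarrow> pos_semidef (A + B)"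
  by (simp add: pos_semidef_def transpose_add matrix_vector_mult_add_rdistrib inner_right_distrib)

lemma pos_semidef_gram:
  fixes Q :: "real^'r^'p"
  assumes "0 \<le> c"
  shows "pos_semidef (c *\<^sub>R (Q ** transpose Q))"
proof -
  have "v \<bullet> ((Q ** transpose Q) *v v) = (norm (transpose Q *v v))\<^sup>2" for v
    by (simp add: matrix_vector_mul_assoc [symmetric] dot_lmul_matrix [symmetric]
        transpose_matrix_vector power2_norm_eq_inner)
  then show ?thesis
    using assms
    by (simp add: pos_semidef_def transpose_scaleR matrix_transpose_mul scaleR_matrix_vector_assoc [symmetric])
qed

lemma loewner_le_refl: "A \<preceq> A"
  by (simp add: loewner_le_def pos_semidef_def transpose_def vec_eq_iff)

lemma loewner_le_trans: "A \<preceq> B \<Longrightarrow> B \<preceq> C \<Longrightarrow> A \<preceq> C"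
  unfolding loewner_le_def using pos_semidef_add [of "B - A" "C - B"] by simp

lemma loewner_le_add: "pos_semidef D \<Longrightarrow> A \<preceq> A + D"
  by (simp add: loewner_le_def)

text \<open>A lower bound by a multiple of the identity is the working form of positive definiteness
  below: it passes to every Loewner-larger matrix, and it allows bounds that are uniform over all
  such matrices.\<close>

lemma pos_defI_mat_le:
  assumes "0 < e" "mat e \<preceq> S"
  shows "pos_def S"
proof -
  have *: "transpose (S - mat e) = S - mat e" and "0 \<le> v \<bullet> ((S - mat e) *v v)" for v
    using assms(2) by (auto simp: loewner_le_def pos_semidef_def)
  then have "e * (v \<bullet> v) \<le> v \<bullet> (S *v v)" for v
    by (simp add: matrix_vector_mult_diff_rdistrib mat_mult inner_diff_right)
  moreover have "transpose S = S"
    using * by (simp add: transpose_diff transpose_mat)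
  ultimately show ?thesis
    unfolding pos_def_def using assms(1)
    by (metis inner_gt_zero_iff less_le_trans mult_pos_pos)
qed

text \<open>The quadratic form attains its minimum on the compact unit sphere. That minimum, the
  smallest eigenvalue, serves as \<open>e\<close>, and homogeneity extends the bound to all
  vectors.\<close>

lemma pos_def_mat_le:
  fixes S :: "real^'p^'p"
  assumes "pos_def S"
  obtains e where "0 < e" "mat e \<preceq> S"
proof -
  let ?q = "\<lambda>v. v \<bullet> (S *v v)"
  have "continuous_on (sphere 0 1) ?q"
    by (intro continuous_on_inner continuous_on_id linear_continuous_on matrix_vector_mul_bounded_linear)
  moreover have "sphere (0 :: real^'p) 1 \<noteq> {}"
    by simp
  ultimately have "\<exists>u \<in> sphere 0 1. \<forall>v \<in> sphere 0 1. ?q u \<le> ?q v"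
    by (intro continuous_attains_inf compact_sphere)
  then obtain u where u: "u \<in> sphere 0 1" "\<And>v. v \<in> sphere 0 1 \<Longrightarrow> ?q u \<le> ?q v"
    by metis
  have "u \<noteq> 0"
    using u(1) by auto
  then have "0 < ?q u"
    using assms by (auto simp: pos_def_def)
  moreover have "mat (?q u) \<preceq> S"
  proof -
    have "?q u * (v \<bullet> v) \<le> ?q v" for v
    proof (cases "v = 0")
      case False
      then have "?q u \<le> ?q (v /\<^sub>R norm v)"
        by (intro u(2)) simp
      also have "\<dots> = ?q v / (v \<bullet> v)"
        by (simp add: matrix_vector_mult_scaleR power2_norm_eq_inner [symmetric] power2_eq_square field_simps)
      finally show ?thesis
        using False by (simp add: field_simps)
    qed simp
    then show ?thesis
      using assms
      by (simp add: loewner_le_def pos_semidef_def pos_def_def transpose_diff transpose_mat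
          matrix_vector_mult_diff_rdistrib mat_mult inner_diff_right)
  qed
  ultimately show thesis
    by (rule that)
qed

text \<open>At a zero of the form, a small step against \<open>D *v v\<close> would lower the form
  to first order and make it negative.\<close>

lemma pos_semidef_kernel:
  assumes "pos_semidef D" "v \<bullet> (D *v v) = 0"
  shows "D *v v = 0"
proof (rule ccontr)
  let ?w = "D *v v"
  assume "?w \<noteq> 0"
  then have a: "0 < ?w \<bullet> ?w"
    by simp
  define b where "b = ?w \<bullet> (D *v ?w)"
  have b: "0 \<le> b" and sym: "transpose D = D"
    using assms(1) by (auto simp: b_def pos_semidef_def)
  \<comment> \<open>The step length is chosen so that \<open>t * b\<close> equals
    \<open>?w \<bullet> ?w - t\<close>, which keeps the quadratic term below the linear one.\<close>
  define t where "t = (?w \<bullet> ?w) / (1 + b)"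
  have t: "t * (1 + b) = ?w \<bullet> ?w" "0 < t"
    using a b by (auto simp: t_def)
  have "0 \<le> (v - t *\<^sub>R ?w) \<bullet> (D *v (v - t *\<^sub>R ?w))"
    using assms(1) by (auto simp: pos_semidef_def)
  also have "\<dots> = t * (t * b - 2 * (?w \<bullet> ?w))"
    using inner_symmetric_matrix [OF sym, of v ?w] assms(2)
    by (simp add: matrix_vector_mult_diff_distrib matrix_vector_mult_scaleR inner_diff_left
        inner_diff_right b_def algebra_simps)
  also have "\<dots> = t * (- t - ?w \<bullet> ?w)"
    unfolding t(1) [symmetric] by (simp add: algebra_simps)
  also have "\<dots> < 0"
    using t(2) a by (intro mult_pos_neg) linarith+
  finally show False
    by simp
qed

text \<open>Symmetric Gaussian elimination: each step splits off one outer product and clears one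
  further coordinate direction.\<close>

lemma pos_semidef_induct [consumes 1, case_names zero outer]:
  fixes D :: "real^'p^'p"
  assumes "pos_semidef D" and zero: "P 0"
    and step: "\<And>D v. pos_semidef D \<Longrightarrow> P D \<Longrightarrow> P (D + outer v)"
  shows "P D"
proof -
  \<comment> \<open>\<open>J\<close> collects the coordinates not yet cleared: the empty set forces
    \<open>D = 0\<close>, and \<open>UNIV\<close> imposes no condition.\<close>
  have "P D" if "finite J" "pos_semidef D" "\<And>i. i \<notin> J \<Longrightarrow> D *v axis i 1 = 0" for J and D :: "real^'p^'p"
    using that
  proof (induction J arbitrary: D rule: finite_induct)
    case empty
    have "D $ a $ b = 0" for a b
      using empty(2) [of b]
      by (simp add: matrix_vector_mult_basis column_def vec_eq_iff)
    then have "D = 0"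
      by (simp add: vec_eq_iff)
    then show ?case
      using zero by simp
  next
    case (insert k J)
    let ?e = "axis k 1 :: real^'p"
    let ?w = "D *v ?e"
    define q where "q = ?e \<bullet> ?w"
    have sym: "transpose D = D" and psd: "0 \<le> v \<bullet> (D *v v)" for v
      using insert.prems(1) by (auto simp: pos_semidef_def)
    show ?case
    proof (cases "q = 0")
      case True
      \<comment> \<open>With a zero pivot the whole column \<open>k\<close> already vanishes, so
        there is nothing to split off.\<close>
      then have "?w = 0"
        using pos_semidef_kernel [OF insert.prems(1)] by (simp add: q_def)
      then show ?thesis
        using insert by (metis insertE)
    next
      case False
      then have q: "0 < q"
        using psd [of ?e] by (simp add: q_def)
      \<comment> \<open>With this scaling \<open>outer v\<close> has the same column
        \<open>k\<close> as \<open>D\<close>, so the difference annihilates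
        \<open>?e\<close>.\<close>
      define v where "v = (1 / sqrt q) *\<^sub>R ?w"
      have outer_v: "outer v *v x = ((?w \<bullet> x) / q) *\<^sub>R ?w" for x
        using q by (simp add: v_def outer_mult)
      have "pos_semidef (D - outer v)"
        unfolding pos_semidef_def
      proof safe
        show "transpose (D - outer v) = D - outer v"
          by (simp add: transpose_diff sym transpose_outer)
        fix x
        \<comment> \<open>This \<open>s\<close> minimises the form of \<open>D\<close> along the
          line \<open>x - s *\<^sub>R ?e\<close>. The minimum is the form of the Schur complement
          \<open>D - outer v\<close> at \<open>x\<close>, which is therefore nonnegative.\<close>
        define s where "s = (?w \<bullet> x) / q"
        have ws: "?w \<bullet> x = s * q"
          using q by (simp add: s_def)
        have wx: "?e \<bullet> (D *v x) = ?w \<bullet> x" "x \<bullet> ?w = ?w \<bullet> x"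
          using inner_symmetric_matrix [OF sym, of ?e x] by (simp_all add: inner_commute)
        have "0 \<le> (x - s *\<^sub>R ?e) \<bullet> (D *v (x - s *\<^sub>R ?e))"
          by (rule psd)
        also have "\<dots> = x \<bullet> (D *v x) - s * (?w \<bullet> x)"
          unfolding matrix_vector_mult_diff_distrib matrix_vector_mult_scaleR inner_diff_left
            inner_diff_right inner_scaleR_left inner_scaleR_right q_def [symmetric] wx ws
          by (simp add: algebra_simps)
        finally show "0 \<le> x \<bullet> ((D - outer v) *v x)"
          by (simp add: matrix_vector_mult_diff_rdistrib inner_diff_right outer_v s_def wx)
      qed
      moreover have "(D - outer v) *v axis i 1 = 0" if "i \<notin> J" for i
      proof (cases "i = k")
        case True
        then show ?thesis
          using q by (simp add: matrix_vector_mult_diff_rdistrib outer_v q_def inner_commute)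
      next
        case False
        \<comment> \<open>Directions cleared earlier stay cleared: by symmetry \<open>?w\<close>,
          and hence \<open>v\<close>, is orthogonal to them.\<close>
        then have z: "D *v axis i 1 = 0"
          using insert.prems(2) that by auto
        then have "?w \<bullet> axis i 1 = 0"
          using inner_symmetric_matrix [OF sym, of "axis i 1" ?e] by (simp add: inner_commute)
        then show ?thesis
          using z by (simp add: matrix_vector_mult_diff_rdistrib outer_v)
      qed
      ultimately show ?thesis
        using insert.IH [of "D - outer v"] step [of "D - outer v" v] by simp
    qed
  qed
  from this [of UNIV D] assms(1) show ?thesis
    by simp
qed

section \<open>Inverses and determinants under rank-one updates\<close>

lemma matrix_inv_eqI:
  fixes A :: "real^'p^'p"
  assumes "A ** B = mat 1"
  shows "matrix_inv A = B"
proof -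
  have BA: "B ** A = mat 1"
    using assms matrix_left_right_inverse by blast
  then have "\<exists>A'. A ** A' = mat 1 \<and> A' ** A = mat 1"
    using assms by blast
  then have inv: "A ** matrix_inv A = mat 1"
    unfolding matrix_inv_def by (rule someI2_ex) simp
  have "matrix_inv A = (B ** A) ** matrix_inv A"
    by (simp add: BA)
  also have "\<dots> = B"
    unfolding matrix_mul_assoc [symmetric] inv by simp
  finally show ?thesis .
qed

text \<open>Definiteness makes the kernel of \<open>S\<close> trivial, which gives the inverse. The
  form of \<open>P\<close> at \<open>v\<close> is the form of \<open>S\<close> at
  \<open>P *v v\<close>, hence nonnegative.\<close>

lemma pos_def_inverse:
  assumes "pos_def S"
  obtains P where "S ** P = mat 1" "transpose P = P" "\<And>v. 0 \<le> v \<bullet> (P *v v)"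
proof -
  have sym: "transpose S = S" and pd: "v \<noteq> 0 \<Longrightarrow> 0 < v \<bullet> (S *v v)" for v
    using assms by (auto simp: pos_def_def)
  have "\<forall>x. S *v x = 0 \<longrightarrow> x = 0"
    by (metis pd inner_zero_right less_irrefl)
  then obtain P where P: "P ** S = mat 1"
    using matrix_left_invertible_ker by blast
  then have SP: "S ** P = mat 1"
    using matrix_left_right_inverse by blast
  have "transpose P ** S = mat 1"
    by (metis SP matrix_transpose_mul sym transpose_mat)
  then have "transpose P = P"
    by (metis SP matrix_mul_assoc matrix_mul_lid matrix_mul_rid)
  moreover have "0 \<le> v \<bullet> (P *v v)" for v
  proof -
    have "v \<bullet> (P *v v) = (P *v v) \<bullet> (S *v (P *v v))"
      by (simp add: matrix_vector_mul_assoc SP inner_commute)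
    then show ?thesis
      by (metis pd inner_zero_left less_imp_le order_refl)
  qed
  ultimately show thesis
    using that SP by blast
qed

lemma matrix_add_rdistrib: "(A + B) ** C = A ** C + B ** (C :: real^'r^'q)"
  by (simp add: vec_eq_iff matrix_matrix_mult_def distrib_right sum.distrib)

lemma det_pos_def_nonzero: "pos_def S \<Longrightarrow> det S \<noteq> 0"
  by (metis det_I det_mul mult_zero_left pos_def_inverse zero_neq_one)

text \<open>After a rotation taking \<open>u\<close> to a coordinate axis, the rank-one perturbation of the identity
  changes a single row.\<close>

lemma det_rank_one_update_id:
  fixes u v :: "real^'p"
  shows "det (mat 1 + (\<chi> i j. u $ i * v $ j)) = 1 + u \<bullet> v"
proof -
  obtain k :: 'p where True by blast
  define a where "a = norm u"
  have "norm u = norm (a *\<^sub>R (axis k 1 :: real^'p))"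
    by (simp add: a_def)
  then obtain f :: "real^'p \<Rightarrow> real^'p"
    where f: "orthogonal_transformation f" "f u = a *\<^sub>R axis k 1"
    using orthogonal_transformation_exists by blast
  define R where "R = matrix f"
  have R: "orthogonal_matrix R"
    using f(1) unfolding R_def orthogonal_transformation_matrix by blast
  have Rf: "R *v x = f x" for x
    unfolding R_def
    using matrix_vector_mul(2) [OF orthogonal_transformation_linear [OF f(1)]] by (rule fun_cong)
  let ?O = "\<lambda>u v. (\<chi> i j. u $ i * v $ j) :: real^'p^'p"
  have O1: "A ** ?O x y = ?O (A *v x) y" for A :: "real^'p^'p" and x y
    by (simp add: vec_eq_iff matrix_matrix_mult_def matrix_vector_mult_def sum_distrib_right mult.assoc)
  have O2: "?O x y ** transpose B = ?O x (B *v y)" for B :: "real^'p^'p" and x y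
    by (simp add: vec_eq_iff matrix_matrix_mult_def matrix_vector_mult_def transpose_def
        sum_distrib_left mult_ac)
  have RR: "R ** transpose R = mat 1"
    using R by (simp add: orthogonal_matrix_def)
  have "R ** (mat 1 + ?O u v) ** transpose R = mat 1 + ?O (R *v u) (R *v v)"
    by (simp add: matrix_add_ldistrib matrix_add_rdistrib O1 O2 RR)
  moreover have "det (R ** (mat 1 + ?O u v) ** transpose R) = det (mat 1 + ?O u v)"
    using arg_cong [OF RR, of det] unfolding det_mul by simp
  moreover have "det (mat 1 + ?O (R *v u) (R *v v)) = 1 + u \<bullet> v"
  proof -
    \<comment> \<open>The transpose differs from the identity only in column \<open>k\<close>, which
      is \<open>y\<close>; the lemma behind Cramer's rule then evaluates its determinant as
      \<open>y $ k\<close>.\<close>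
    define y where "y = a *\<^sub>R (R *v v) + axis k 1"
    have "transpose (mat 1 + ?O (R *v u) (R *v v)) =
        (\<chi> i j. if j = k then (mat 1 *v y) $ i else mat 1 $ i $ j)"
      unfolding matrix_vector_mul_lid
      by (auto simp: vec_eq_iff transpose_def Rf f(2) y_def mat_def axis_def)
    then have "det (transpose (mat 1 + ?O (R *v u) (R *v v))) = y $ k * det (mat 1 :: real^'p^'p)"
      by (simp only: cramer_lemma)
    then have "det (mat 1 + ?O (R *v u) (R *v v)) = y $ k"
      by (simp add: det_transpose)
    also have "\<dots> = 1 + f u \<bullet> f v"
      by (simp add: y_def Rf f(2) inner_axis')
    also have "\<dots> = 1 + u \<bullet> v"
      using f(1) by (simp add: orthogonal_transformation_def)
    finally show ?thesis .
  qed
  ultimately show ?thesis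
    by simp
qed

text \<open>Matrix determinant lemma: factoring out \<open>S\<close> leaves a rank-one perturbation
  of the identity, with vectors \<open>P *v v\<close> and \<open>v\<close>.\<close>

lemma det_add_outer:
  fixes S P :: "real^'p^'p"
  assumes "S ** P = mat 1"
  shows "det (S + outer v) = det S * (1 + v \<bullet> (P *v v))"
proof -
  have "S ** (\<chi> i j. (P *v v) $ i * v $ j) = (\<chi> i j. (S *v (P *v v)) $ i * v $ j)"
    by (simp add: vec_eq_iff matrix_matrix_mult_def matrix_vector_mult_def sum_distrib_right mult.assoc)
  also have "\<dots> = outer v"
    by (simp add: matrix_vector_mul_assoc assms outer_def)
  finally have "S + outer v = S ** (mat 1 + (\<chi> i j. (P *v v) $ i * v $ j))"
    by (simp add: matrix_add_ldistrib)
  then show ?thesis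
    by (simp add: det_mul det_rank_one_update_id inner_commute)
qed

text \<open>Sherman--Morrison, in the form applied to a vector, as it occurs in the density.
  Nonnegativity of \<open>v \<bullet> (P *v v)\<close> keeps the denominator away from zero, and the
  candidate \<open>?B\<close> is checked to be a right inverse by its action on every
  vector.\<close>

lemma matrix_inv_add_outer:
  fixes S P :: "real^'p^'p"
  assumes SP: "S ** P = mat 1" and sym: "transpose P = P" and pos: "0 \<le> v \<bullet> (P *v v)"
  shows "matrix_inv (S + outer v) *v x = P *v x - ((v \<bullet> (P *v x)) / (1 + v \<bullet> (P *v v))) *\<^sub>R (P *v v)"
proof -
  define q where "q = v \<bullet> (P *v v)"
  have q: "1 + q \<noteq> 0"
    using pos by (simp add: q_def)
  let ?B = "P - (1 / (1 + q)) *\<^sub>R outer (P *v v)"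
  have B: "?B *v y = P *v y - ((v \<bullet> (P *v y)) / (1 + q)) *\<^sub>R (P *v v)" for y
    using inner_symmetric_matrix [OF sym, of v y]
    by (simp add: matrix_vector_mult_diff_rdistrib scaleR_matrix_vector_assoc [symmetric] outer_mult inner_commute)
  have "((S + outer v) ** ?B) *v y = y" for y
  proof -
    have "((S + outer v) ** ?B) *v y = S *v (?B *v y) + outer v *v (?B *v y)"
      by (simp add: matrix_vector_mul_assoc [symmetric] matrix_vector_mult_add_rdistrib)
    also have "S *v (?B *v y) = y - ((v \<bullet> (P *v y)) / (1 + q)) *\<^sub>R v"
      unfolding B by (simp add: matrix_vector_mult_diff_distrib matrix_vector_mult_scaleR
          matrix_vector_mul_assoc SP)
    also have "outer v *v (?B *v y) = ((v \<bullet> (P *v y)) / (1 + q)) *\<^sub>R v"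
      unfolding B outer_mult inner_diff_right inner_scaleR_right q_def [symmetric]
      using q by (simp add: field_simps)
    finally show ?thesis
      by simp
  qed
  then have "(S + outer v) ** ?B = mat 1"
    by (metis matrix_eq matrix_vector_mul_lid)
  from matrix_inv_eqI [OF this] B show ?thesis
    by (simp add: q_def)
qed

section \<open>Gaussian convolution\<close>

abbreviation std_gauss :: "real measure" where
  "std_gauss \<equiv> density lborel std_normal_density"

text \<open>Completing the square turns the integrand into a constant multiple of the normal density
  with mean \<open>b / (1 + q)\<close> and variance \<open>1 / (1 + q)\<close>, whose integral is
  one.\<close>

lemma gauss_integral_exp_quadratic:
  fixes b q :: real
  assumes "0 \<le> q"
  shows "(LINT t|std_gauss. exp (t * b - q * t\<^sup>2 / 2)) = exp (b\<^sup>2 / (2 * (1 + q))) / sqrt (1 + q)"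
proof -
  define c where "c = 1 + q"
  have c: "0 < c" and q: "q = c - 1"
    using assms by (auto simp: c_def)
  have sq: "(1 / sqrt c)\<^sup>2 = 1 / c"
    using c by (simp add: power_divide)
  have "(LINT t|std_gauss. exp (t * b - q * t\<^sup>2 / 2)) =
      (LINT t|lborel. std_normal_density t * exp (t * b - q * t\<^sup>2 / 2))"
    by (subst integral_density) auto
  also have "\<dots> = (LINT t|lborel. exp (b\<^sup>2 / (2 * c)) / sqrt c * normal_density (b / c) (1 / sqrt c) t)"
  proof (rule Bochner_Integration.integral_cong [OF refl])
    fix t
    have "- t\<^sup>2 / 2 + (t * b - q * t\<^sup>2 / 2) = b\<^sup>2 / (2 * c) + - (t - b / c)\<^sup>2 / (2 * (1 / c))"
      using c unfolding q by (simp add: power2_eq_square field_simps)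
    then have "exp (- t\<^sup>2 / 2) * exp (t * b - q * t\<^sup>2 / 2) =
        exp (b\<^sup>2 / (2 * c)) * exp (- (t - b / c)\<^sup>2 / (2 * (1 / c)))"
      by (metis exp_add)
    moreover have "1 / sqrt (2 * pi * (1 / c)) = sqrt c / sqrt (2 * pi)"
      using c by (simp add: real_sqrt_divide)
    ultimately show "std_normal_density t * exp (t * b - q * t\<^sup>2 / 2) =
        exp (b\<^sup>2 / (2 * c)) / sqrt c * normal_density (b / c) (1 / sqrt c) t"
      unfolding std_normal_density_def normal_density_def sq using c by simp
  qed
  also have "\<dots> = exp (b\<^sup>2 / (2 * c)) / sqrt c"
    using c by simp
  finally show ?thesis
    by (simp add: c_def)
qed

text \<open>For a standard normal \<open>t\<close>, the vector \<open>t *\<^sub>R v\<close> has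
  covariance \<open>outer v\<close>; adding it independently adds the covariances.\<close>

lemma mvn_density_add_outer:
  fixes S :: "real^'p^'p"
  assumes "pos_def S"
  shows "mvn_density 0 (S + outer v) x = (LINT t|std_gauss. mvn_density 0 S (x - t *\<^sub>R v))"
proof -
  obtain P where SP: "S ** P = mat 1" and sym: "transpose P = P" and psd: "\<And>v. 0 \<le> v \<bullet> (P *v v)"
    using pos_def_inverse [OF assms] by metis
  define q where "q = v \<bullet> (P *v v)"
  define b where "b = v \<bullet> (P *v x)"
  define a where "a = x \<bullet> (P *v x)"
  define d where "d = sqrt ((2 * pi) ^ CARD('p) * det S)"
  have q: "0 \<le> q"
    using psd by (simp add: q_def)
  have xv: "x \<bullet> (P *v v) = b"
    using inner_symmetric_matrix [OF sym] by (simp add: b_def)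
  have quad: "(x - t *\<^sub>R v) \<bullet> (P *v (x - t *\<^sub>R v)) = a - 2 * (t * b) + q * t\<^sup>2" for t
    by (simp add: matrix_vector_mult_diff_distrib matrix_vector_mult_scaleR inner_diff_left
        inner_diff_right xv a_def [symmetric] b_def [symmetric] q_def [symmetric] power2_eq_square algebra_simps)
  have "mvn_density 0 S (x - t *\<^sub>R v) = exp (- a / 2) / d * exp (t * b - q * t\<^sup>2 / 2)" for t
    unfolding mvn_density_def matrix_inv_eqI [OF SP] diff_0_right quad d_def
    by (simp add: exp_add [symmetric] field_simps)
  then have "(LINT t|std_gauss. mvn_density 0 S (x - t *\<^sub>R v)) =
      exp (- a / 2) / d * (exp (b\<^sup>2 / (2 * (1 + q))) / sqrt (1 + q))"
    by (simp add: gauss_integral_exp_quadratic [OF q])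
  also have "\<dots> = exp (- (a - b\<^sup>2 / (1 + q)) / 2) / (d * sqrt (1 + q))"
  proof -
    have "- (a - b\<^sup>2 / (1 + q)) / 2 = - a / 2 + b\<^sup>2 / (2 * (1 + q))"
      using q by (simp add: field_simps)
    then have "exp (- (a - b\<^sup>2 / (1 + q)) / 2) = exp (- a / 2) * exp (b\<^sup>2 / (2 * (1 + q)))"
      by (simp only: exp_add)
    then show ?thesis
      by simp
  qed
  \<comment> \<open>The two traces of the integration over \<open>t\<close> are absorbed separately:
    \<open>sqrt (1 + q)\<close> by the determinant formula, then \<open>b\<^sup>2 / (1 + q)\<close>
    by Sherman--Morrison.\<close>
  also have "d * sqrt (1 + q) = sqrt ((2 * pi) ^ CARD('p) * det (S + outer v))"
    by (simp add: det_add_outer [OF SP] d_def q_def real_sqrt_mult)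
  also have "a - b\<^sup>2 / (1 + q) = x \<bullet> (matrix_inv (S + outer v) *v x)"
    unfolding matrix_inv_add_outer [OF SP sym psd] inner_diff_right inner_scaleR_right xv
      a_def [symmetric] b_def [symmetric] q_def [symmetric]
    by (simp add: power2_eq_square)
  finally show ?thesis
    by (simp add: mvn_density_def)
qed

text \<open>Each observation has its own covariance, because noise is added to one observation at a
  time and the intermediate samples are not identically distributed.\<close>

definition indep_normal_density :: "('n \<Rightarrow> real^'p^'p) \<Rightarrow> real^'p^'n \<Rightarrow> real" where
  "indep_normal_density S x = (\<Prod>i\<in>UNIV. mvn_density 0 (S i) (x $ i))"

text \<open>The noise \<open>axis j v\<close> moves observation \<open>j\<close> alone, so the other
  factors are constant in \<open>t\<close> and leave the integral.\<close>

lemma indep_normal_density_update: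
  fixes S :: "'n::finite \<Rightarrow> real^'p^'p"
  assumes "pos_def (S j)"
  shows "indep_normal_density (S(j := S j + outer v)) x =
    (LINT t|std_gauss. indep_normal_density S (x - t *\<^sub>R axis j v))"
proof -
  let ?r = "\<Prod>i\<in>UNIV - {j}. mvn_density 0 (S i) (x $ i)"
  have "indep_normal_density S (x - t *\<^sub>R axis j v) = mvn_density 0 (S j) (x $ j - t *\<^sub>R v) * ?r" for t
    unfolding indep_normal_density_def
    by (subst prod.remove [of _ j]) (auto simp: axis_def intro!: prod.cong)
  moreover have "indep_normal_density (S(j := S j + outer v)) x = mvn_density 0 (S j + outer v) (x $ j) * ?r"
    unfolding indep_normal_density_def
    by (subst prod.remove [of _ j]) (auto intro!: prod.cong)
  ultimately show ?thesis
    by (simp add: mvn_density_add_outer [OF assms])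
qed

section \<open>Joint measurability in the covariance and the sample\<close>

lemma borel_measurable_det:
  fixes A :: "'w \<Rightarrow> real^'p^'p"
  assumes [measurable]: "\<And>i j. (\<lambda>\<omega>. A \<omega> $ i $ j) \<in> borel_measurable M"
  shows "(\<lambda>\<omega>. det (A \<omega>)) \<in> borel_measurable M"
  unfolding det_def by measurable

text \<open>Writes the inverse through quotients of determinants, so that its measurable dependence
  on the entries becomes evident.\<close>

lemma matrix_inv_cramer:
  fixes A :: "real^'p^'p"
  assumes "det A \<noteq> 0"
  shows "matrix_inv A *v x = (\<chi> k. det (\<chi> i j. if j = k then x $ i else A $ i $ j) / det A)"
proof -
  obtain B where B: "A ** B = mat 1"
    using assms invertible_det_nz [of A] by (auto simp: invertible_def)
  then have "A *v (matrix_inv A *v x) = x"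
    by (simp add: matrix_vector_mul_assoc matrix_inv_eqI [OF B] B)
  then show ?thesis
    by (simp add: cramer [OF assms])
qed

lemma borel_measurable_mvn_density:
  fixes A :: "'w \<Rightarrow> real^'p^'p"
  assumes [measurable]: "\<And>i j. (\<lambda>\<omega>. A \<omega> $ i $ j) \<in> borel_measurable M"
    and [measurable]: "\<And>i. (\<lambda>\<omega>. x \<omega> $ i) \<in> borel_measurable M"
    and nz: "\<And>\<omega>. det (A \<omega>) \<noteq> 0"
  shows "(\<lambda>\<omega>. mvn_density 0 (A \<omega>) (x \<omega>)) \<in> borel_measurable M"
proof -
  have [measurable]: "(\<lambda>\<omega>. det (\<chi> i j. if j = k then x \<omega> $ i else A \<omega> $ i $ j)) \<in> borel_measurable M" for k
    by (rule borel_measurable_det) (auto split: if_splits)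
  have [measurable]: "(\<lambda>\<omega>. det (A \<omega>)) \<in> borel_measurable M"
    by (rule borel_measurable_det) measurable
  show ?thesis
    unfolding mvn_density_def matrix_inv_cramer [OF nz] inner_vec_def diff_0_right by simp
qed

lemma borel_measurable_vec_nth_nth [measurable]:
  assumes [measurable]: "f \<in> borel_measurable M"
  shows "(\<lambda>\<omega>. (f \<omega> :: real^'p^'n) $ i $ j) \<in> borel_measurable M"
proof -
  have "(\<lambda>x :: real^'p^'n. x $ i $ j) \<in> borel_measurable borel"
    by (intro borel_measurable_continuous_onI continuous_intros)
  from measurable_compose [OF assms this] show ?thesis .
qed

lemma borel_measurable_indep_normal_density:
  fixes S :: "'w \<Rightarrow> 'n::finite \<Rightarrow> real^'p^'p"
  assumes [measurable]: "\<And>i. (\<lambda>\<omega>. S \<omega> i) \<in> borel_measurable M" "x \<in> borel_measurable M"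
    and nz: "\<And>\<omega> i. det (S \<omega> i) \<noteq> 0"
  shows "(\<lambda>\<omega>. indep_normal_density (S \<omega>) (x \<omega>)) \<in> borel_measurable M"
  unfolding indep_normal_density_def
  by (intro borel_measurable_prod borel_measurable_mvn_density nz) measurable

section \<open>Averages of translates and the L1 norm\<close>

lemma nn_integral_lborel_translate:
  fixes c :: "'a::euclidean_space"
  assumes [measurable]: "f \<in> borel_measurable borel"
  shows "(\<integral>\<^sup>+x. f (x - c) \<partial>lborel) = (\<integral>\<^sup>+x. f x \<partial>lborel)"
proof -
  have "(\<integral>\<^sup>+x. f x \<partial>lborel) = (\<integral>\<^sup>+x. f x \<partial>distr lborel borel ((+) (- c)))"
    by (simp only: lborel_distr_plus)
  also have "\<dots> = (\<integral>\<^sup>+x. f (- c + x) \<partial>lborel)"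
    by (rule nn_integral_distr) auto
  finally show ?thesis
    by simp
qed

text \<open>The absolute value moves inside the average, Tonelli exchanges the integrals, and each
  translate has the same norm as \<open>h\<close>. Nonnegative integrals make this valid even for
  infinite norm.\<close>

lemma nn_integral_abs_smoothing_le:
  fixes h :: "'a::euclidean_space \<Rightarrow> real"
  assumes h [measurable]: "h \<in> borel_measurable borel" and "prob_space \<mu>"
    and sets [measurable_cong]: "sets \<mu> = sets borel"
  shows "(\<integral>\<^sup>+x. ennreal \<bar>LINT t|\<mu>. h (x - t *\<^sub>R w)\<bar> \<partial>lborel) \<le> (\<integral>\<^sup>+x. ennreal \<bar>h x\<bar> \<partial>lborel)"
proof -
  interpret \<mu>: prob_space \<mu> by fact
  interpret pair_sigma_finite \<mu> "lborel :: 'a measure" ..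
  have "(\<integral>\<^sup>+x. ennreal \<bar>LINT t|\<mu>. h (x - t *\<^sub>R w)\<bar> \<partial>lborel)
      \<le> (\<integral>\<^sup>+x. (\<integral>\<^sup>+t. ennreal \<bar>h (x - t *\<^sub>R w)\<bar> \<partial>\<mu>) \<partial>lborel)"
  proof (rule nn_integral_mono)
    fix x
    show "ennreal \<bar>LINT t|\<mu>. h (x - t *\<^sub>R w)\<bar> \<le> (\<integral>\<^sup>+t. ennreal \<bar>h (x - t *\<^sub>R w)\<bar> \<partial>\<mu>)"
      using integral_norm_bound_ennreal [of \<mu> "\<lambda>t. h (x - t *\<^sub>R w)"]
      \<comment> \<open>Without integrability the Bochner integral is 0 by convention, and the bound
        is trivial.\<close>
      by (cases "integrable \<mu> (\<lambda>t. h (x - t *\<^sub>R w))") (auto simp: not_integrable_integral_eq)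
  qed
  also have "\<dots> = (\<integral>\<^sup>+t. (\<integral>\<^sup>+x. ennreal \<bar>h (x - t *\<^sub>R w)\<bar> \<partial>lborel) \<partial>\<mu>)"
    by (rule Fubini') measurable
  also have "\<dots> = (\<integral>\<^sup>+t. (\<integral>\<^sup>+x. ennreal \<bar>h x\<bar> \<partial>lborel) \<partial>\<mu>)"
    by (intro nn_integral_cong nn_integral_lborel_translate [where f = "\<lambda>x. ennreal \<bar>h x\<bar>"]) measurable
  also have "\<dots> = (\<integral>\<^sup>+x. ennreal \<bar>h x\<bar> \<partial>lborel)"
    by (simp add: \<mu>.emeasure_space_1)
  finally show ?thesis .
qed

section \<open>Domination and finite mass\<close>

text \<open>Observations are treated in turn, and each difference \<open>T j - S j\<close> is built
  up from outer products. The step keeps \<open>S i \<preceq> R i\<close>, so that lower bounds on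
  \<open>S\<close> reach every intermediate family.\<close>

lemma loewner_family_induct [consumes 1, case_names base outer]:
  fixes S T :: "'n::finite \<Rightarrow> real^'p^'p"
  assumes "\<And>i. S i \<preceq> T i" and base: "P S"
    and step: "\<And>R j v. (\<And>i. S i \<preceq> R i) \<Longrightarrow> P R \<Longrightarrow> P (R(j := R j + outer v))"
  shows "P T"
proof -
  have "P (\<lambda>i. if i \<in> J then T i else S i)" if "finite J" for J
    using that
  proof (induction J rule: finite_induct)
    case empty
    then show ?case
      using base by simp
  next
    case (insert j J)
    \<comment> \<open>Hybrid family: the observations in \<open>J\<close> have already reached their
      target covariance.\<close>
    let ?R = "\<lambda>i. if i \<in> J then T i else S i"
    have "P (?R(j := S j + D))" if "pos_semidef D" for D
      using that
    proof (induction D rule: pos_semidef_induct)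
      case zero
      have "?R(j := S j + 0) = ?R"
        using insert.hyps by auto
      then show ?case
        using insert.IH by simp
    next
      case (outer D v)
      have le: "S i \<preceq> (?R(j := S j + D)) i" for i
        using assms(1) outer.hyps by (auto simp: loewner_le_refl loewner_le_add)
      have "?R(j := S j + (D + outer v)) = (?R(j := S j + D))(j := (?R(j := S j + D)) j + outer v)"
        by (simp add: add.assoc)
      with step [OF le outer.IH, of j v] show ?case
        by (rule ssubst [rotated])
    qed
    from this [of "T j - S j"] have "P (?R(j := T j))"
      using assms(1) [of j] by (simp add: loewner_le_def)
    moreover have "?R(j := T j) = (\<lambda>i. if i \<in> insert j J then T i else S i)"
      by auto
    ultimately show ?case
      by (simp only:)
  qed
  from this [of UNIV] show ?thesis
    by simp
qed

lemma borel_measurable_indep_normal_density_fixed: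
  assumes "\<And>i. pos_def (S i)"
  shows "indep_normal_density S \<in> borel_measurable borel"
  by (rule borel_measurable_indep_normal_density [where S = "\<lambda>_. S" and x = "\<lambda>x. x", simplified])
     (simp_all add: det_pos_def_nonzero assms)

lemma det_mat: "det (mat e :: real^'p^'p) = e ^ CARD('p)"
  by (subst det_diagonal) (auto simp: mat_def)

lemma mvn_density_mat:
  fixes x :: "real^'p"
  assumes "0 < e"
  shows "mvn_density 0 (mat e) x = exp (- (x \<bullet> x) / (2 * e)) / sqrt ((2 * pi * e) ^ CARD('p))"
proof -
  have "(mat e :: real^'p^'p) ** mat (1 / e) = mat 1"
    unfolding matrix_eq using assms by (simp add: matrix_vector_mul_assoc [symmetric] mat_mult)
  from matrix_inv_eqI [OF this] show ?thesis
    using assms by (simp add: mvn_density_def mat_mult det_mat power_mult_distrib mult.commute)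
qed

lemma indep_normal_density_mat:
  fixes x :: "real^'p^'n"
  assumes "0 < e"
  shows "indep_normal_density (\<lambda>_. mat e) x =
    exp (- (x \<bullet> x) / (2 * e)) / sqrt ((2 * pi * e) ^ CARD('p)) ^ CARD('n)"
proof -
  have "(\<Sum>i\<in>UNIV. - (x $ i \<bullet> x $ i) / (2 * e)) = - (x \<bullet> x) / (2 * e)"
    by (simp add: inner_vec_def [of x x] sum_negf sum_divide_distrib)
  then show ?thesis
    by (simp add: indep_normal_density_def mvn_density_mat [OF assms] prod_dividef exp_sum [symmetric])
qed

text \<open>The integrand factors over the basis into one-dimensional unnormalised normal
  densities.\<close>

lemma nn_integral_exp_neg_square_norm_finite:
  assumes "0 < e"
  shows "(\<integral>\<^sup>+x. ennreal (exp (- (x \<bullet> x) / (2 * e))) \<partial>(lborel :: 'a::euclidean_space measure)) < \<infinity>"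
proof -
  have "exp (- t\<^sup>2 / (2 * e)) = sqrt (2 * pi * e) * normal_density 0 (sqrt e) t" for t
    using assms by (simp add: normal_density_def real_sqrt_mult)
  then have fin: "(\<integral>\<^sup>+t. ennreal (exp (- t\<^sup>2 / (2 * e))) \<partial>lborel) < \<infinity>"
    using assms by (simp add: ennreal_mult nn_integral_cmult nn_integral_eq_integral ennreal_mult_less_top)
  have "exp (- (x \<bullet> x) / (2 * e)) = (\<Prod>b\<in>Basis. exp (- (x \<bullet> b)\<^sup>2 / (2 * e)))" for x :: 'a
    by (simp add: exp_sum [symmetric] euclidean_inner [of x x] power2_eq_square sum_negf sum_divide_distrib)
  then have "(\<integral>\<^sup>+x. ennreal (exp (- (x \<bullet> x) / (2 * e))) \<partial>(lborel :: 'a measure)) =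
      (\<integral>\<^sup>+x. (\<Prod>b\<in>Basis. ennreal (exp (- (x \<bullet> b)\<^sup>2 / (2 * e)))) \<partial>(lborel :: 'a measure))"
    by (simp add: prod_ennreal)
  also have "\<dots> = (\<Prod>b\<in>(Basis :: 'a set). (\<integral>\<^sup>+t. ennreal (exp (- t\<^sup>2 / (2 * e))) \<partial>lborel))"
    by (rule nn_integral_lborel_prod) auto
  also have "\<dots> < \<infinity>"
    using fin by (simp add: power_less_top_ennreal)
  finally show ?thesis .
qed

text \<open>For covariance \<open>mat e\<close> the density lies between 0 and its value at the
  origin, and averaging translates preserves these bounds. Since \<open>C\<close> does not depend on
  \<open>T\<close>, it dominates all components of a mixture at once.\<close>

lemma indep_normal_density_dominated:
  assumes e: "0 < e"
  obtains C where
    "\<And>(T :: 'n::finite \<Rightarrow> real^'p^'p) x. (\<And>i. mat e \<preceq> T i) \<Longrightarrow> 0 \<le> indep_normal_density T x \<and> indep_normal_density T x \<le> C"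
proof -
  let ?D = "sqrt ((2 * pi * e) ^ CARD('p)) ^ CARD('n)"
  have D: "0 < ?D"
    using e by simp
  have "\<forall>x. 0 \<le> indep_normal_density T x \<and> indep_normal_density T x \<le> 1 / ?D"
    if "\<And>i. mat e \<preceq> T i" for T :: "'n \<Rightarrow> real^'p^'p"
    using that
  proof (induction T rule: loewner_family_induct)
    case base
    then show ?case
      using D e by (auto simp: indep_normal_density_mat intro!: divide_right_mono)
  next
    case (outer R j v)
    have pd: "pos_def (R i)" for i
      using pos_defI_mat_le [OF e outer.hyps] .
    interpret prob_space std_gauss
      by (rule prob_space_normal_density) simp
    have meas [measurable]: "indep_normal_density R \<in> borel_measurable borel"
      by (rule borel_measurable_indep_normal_density_fixed [OF pd])
    show ?case
    proof
      fix x
      let ?f = "\<lambda>t. indep_normal_density R (x - t *\<^sub>R axis j v)"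
      have "integrable std_gauss ?f"
        using outer.IH by (intro integrable_const_bound [where B = "1 / ?D"]) auto
      then have "0 \<le> integral\<^sup>L std_gauss ?f \<and> integral\<^sup>L std_gauss ?f \<le> 1 / ?D"
        using outer.IH integral_le_const [of ?f "1 / ?D"]
        by (auto intro!: integral_nonneg_AE)
      then show "0 \<le> indep_normal_density (R(j := R j + outer v)) x \<and>
          indep_normal_density (R(j := R j + outer v)) x \<le> 1 / ?D"
        by (simp add: indep_normal_density_update [where S = R, OF pd])
    qed
  qed
  then show thesis
    using that by blast
qed

text \<open>Each elementary update is a smoothing and does not increase the mass, which gives a
  bound uniform in \<open>T\<close>.\<close>

lemma nn_integral_indep_normal_density_le:
  fixes T :: "'n::finite \<Rightarrow> real^'p^'p"
  assumes e: "0 < e" and T: "\<And>i. mat e \<preceq> T i"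
  shows "(\<integral>\<^sup>+x. ennreal \<bar>indep_normal_density T x\<bar> \<partial>lborel)
    \<le> (\<integral>\<^sup>+x. ennreal \<bar>indep_normal_density (\<lambda>_ :: 'n. mat e :: real^'p^'p) x\<bar> \<partial>lborel)"
  using T
proof (induction T rule: loewner_family_induct)
  case base
  show ?case ..
next
  case (outer R j v)
  have pd: "pos_def (R i)" for i
    using pos_defI_mat_le [OF e outer.hyps] .
  show ?case
    unfolding indep_normal_density_update [where S = R, OF pd]
    by (rule order_trans [OF nn_integral_abs_smoothing_le outer.IH])
       (simp_all add: borel_measurable_indep_normal_density_fixed [OF pd] prob_space_normal_density)
qed

lemma nn_integral_indep_normal_density_mat_finite:
  assumes e: "0 < e"
  shows "(\<integral>\<^sup>+x. ennreal \<bar>indep_normal_density (\<lambda>_ :: 'n::finite. mat e :: real^'p^'p) x\<bar> \<partial>lborel) < \<infinity>"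
proof -
  let ?D = "sqrt ((2 * pi * e) ^ CARD('p)) ^ CARD('n)"
  have D: "0 < ?D"
    using e by simp
  have "(\<integral>\<^sup>+x. ennreal \<bar>indep_normal_density (\<lambda>_ :: 'n. mat e :: real^'p^'p) x\<bar> \<partial>lborel) =
      (\<integral>\<^sup>+x. ennreal (1 / ?D) * ennreal (exp (- (x \<bullet> x) / (2 * e))) \<partial>(lborel :: (real^'p^'n) measure))"
    using D by (simp add: indep_normal_density_mat [OF e] ennreal_mult [symmetric] abs_of_pos)
  also have "\<dots> = ennreal (1 / ?D) * (\<integral>\<^sup>+x. ennreal (exp (- (x \<bullet> x) / (2 * e))) \<partial>(lborel :: (real^'p^'n) measure))"
    by (rule nn_integral_cmult) measurable
  also have "\<dots> < \<infinity>"
    using nn_integral_exp_neg_square_norm_finite [OF e, where 'a = "real^'p^'n"]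
    by (simp add: ennreal_mult_less_top)
  finally show ?thesis .
qed

section \<open>Contraction of the mixture gap\<close>

text \<open>The same convolution kernel acts on every component of the mixture and on the null density,
  hence on this difference.\<close>

definition mixture_gap :: "'w measure \<Rightarrow> ('w \<Rightarrow> real^'p^'p) \<Rightarrow> ('n \<Rightarrow> real^'p^'p) \<Rightarrow> real^'p^'n \<Rightarrow> real" where
  "mixture_gap M A S x =
    (LINT \<omega>|M. indep_normal_density (\<lambda>i. S i + A \<omega>) x) - indep_normal_density S x"

text \<open>The spike is a measurable random positive semidefinite matrix \<open>A\<close>;
  \<open>e\<close> is the common lower bound that keeps every covariance positive definite.\<close>

context
  fixes M :: "'w measure" and A :: "'w \<Rightarrow> real^'p^'p" and e :: real
  assumes prob: "prob_space M"
    and A [measurable]: "A \<in> borel_measurable M"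
    and psd: "\<And>\<omega>. pos_semidef (A \<omega>)"
    and e: "0 < e"
begin

lemma mat_le_shift: "mat e \<preceq> S \<Longrightarrow> mat e \<preceq> S + A \<omega>"
  using loewner_le_trans loewner_le_add [OF psd] by blast

text \<open>Mixing variable and sample are arbitrary measurable functions of \<open>z\<close>, which
  covers the product spaces in either order.\<close>

lemma borel_measurable_shifted:
  fixes S :: "'n::finite \<Rightarrow> real^'p^'p"
  assumes S: "\<And>i. mat e \<preceq> S i"
    and [measurable]: "f \<in> measurable N M" "g \<in> borel_measurable N"
  shows "(\<lambda>z. indep_normal_density (\<lambda>i. S i + A (f z)) (g z)) \<in> borel_measurable N"
  by (rule borel_measurable_indep_normal_density)
     (simp_all add: det_pos_def_nonzero pos_defI_mat_le [OF e mat_le_shift [OF S]])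

lemma borel_measurable_mixture_gap:
  fixes S :: "'n::finite \<Rightarrow> real^'p^'p"
  assumes S: "\<And>i. mat e \<preceq> S i"
  shows "mixture_gap M A S \<in> borel_measurable borel"
proof -
  interpret prob_space M by (rule prob)
  have [measurable]: "(\<lambda>(x, \<omega>). indep_normal_density (\<lambda>i. S i + A \<omega>) x) \<in> borel_measurable (borel \<Otimes>\<^sub>M M)"
    unfolding case_prod_beta by (rule borel_measurable_shifted [OF S]) measurable
  have [measurable]: "indep_normal_density S \<in> borel_measurable borel"
    by (rule borel_measurable_indep_normal_density_fixed) (rule pos_defI_mat_le [OF e S])
  show ?thesis
    unfolding mixture_gap_def by measurable
qed

text \<open>The noise is independent of the mixing variable, so Fubini moves the average over
  \<open>t\<close> outside the mixture.\<close>

lemma mixture_gap_update: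
  fixes S :: "'n::finite \<Rightarrow> real^'p^'p"
  assumes S: "\<And>i. mat e \<preceq> S i"
  shows "mixture_gap M A (S(j := S j + outer v)) x =
    (LINT t|std_gauss. mixture_gap M A S (x - t *\<^sub>R axis j v))"
proof -
  interpret M: prob_space M by (rule prob)
  interpret N: prob_space std_gauss
    by (rule prob_space_normal_density) simp
  interpret pair_prob_space std_gauss M ..
  obtain C where C: "\<And>(T :: 'n \<Rightarrow> real^'p^'p) x. (\<And>i. mat e \<preceq> T i) \<Longrightarrow>
      0 \<le> indep_normal_density T x \<and> indep_normal_density T x \<le> C"
    using indep_normal_density_dominated [OF e] by blast
  let ?y = "\<lambda>t. x - t *\<^sub>R axis j v"
  let ?F = "\<lambda>t \<omega>. indep_normal_density (\<lambda>i. S i + A \<omega>) (?y t)"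
  have [measurable]: "case_prod ?F \<in> borel_measurable (std_gauss \<Otimes>\<^sub>M M)"
    unfolding case_prod_beta by (rule borel_measurable_shifted [OF S]) measurable
  have [measurable]: "indep_normal_density S \<in> borel_measurable borel"
    by (rule borel_measurable_indep_normal_density_fixed) (rule pos_defI_mat_le [OF e S])
  \<comment> \<open>The uniform bound \<open>C\<close> suffices, since the product is a probability
    space.\<close>
  have int: "integrable (std_gauss \<Otimes>\<^sub>M M) (case_prod ?F)"
    using C [OF mat_le_shift [OF S]] by (intro integrable_const_bound [where B = C]) auto
  have int0: "integrable std_gauss (\<lambda>t. indep_normal_density S (?y t))"
    using C [OF S] by (intro N.integrable_const_bound [where B = C]) auto
  have shift: "indep_normal_density (\<lambda>i. (S(j := S j + outer v)) i + A \<omega>) x = (LINT t|std_gauss. ?F t \<omega>)" for \<omega>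
  proof -
    \<comment> \<open>Adding \<open>A \<omega>\<close> commutes with adding \<open>outer v\<close>,
      so the kernel is the same for every \<omega>.\<close>
    have "(\<lambda>i. (S(j := S j + outer v)) i + A \<omega>) = (\<lambda>i. S i + A \<omega>)(j := (S j + A \<omega>) + outer v)"
      by (auto simp: algebra_simps)
    then show ?thesis
      using indep_normal_density_update [of "\<lambda>i. S i + A \<omega>" j v x]
        pos_defI_mat_le [OF e mat_le_shift [OF S]] by simp
  qed
  have "mixture_gap M A (S(j := S j + outer v)) x =
      (LINT \<omega>|M. LINT t|std_gauss. ?F t \<omega>) - (LINT t|std_gauss. indep_normal_density S (?y t))"
    unfolding mixture_gap_def shift
    by (simp only: indep_normal_density_update [where S = S, OF pos_defI_mat_le [OF e S]])
  also have "\<dots> = (LINT t|std_gauss. LINT \<omega>|M. ?F t \<omega>) - (LINT t|std_gauss. indep_normal_density S (?y t))"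
    by (simp only: Fubini_integral [OF int])
  also have "\<dots> = (LINT t|std_gauss. mixture_gap M A S (?y t))"
    unfolding mixture_gap_def
    using integrable_fst' [OF int] int0 by (simp add: Bochner_Integration.integral_diff)
  finally show ?thesis .
qed

lemma nn_integral_mixture_gap_mono:
  fixes S T :: "'n::finite \<Rightarrow> real^'p^'p"
  assumes S: "\<And>i. mat e \<preceq> S i" and ST: "\<And>i. S i \<preceq> T i"
  shows "(\<integral>\<^sup>+x. ennreal \<bar>mixture_gap M A T x\<bar> \<partial>lborel) \<le> (\<integral>\<^sup>+x. ennreal \<bar>mixture_gap M A S x\<bar> \<partial>lborel)"
  using ST
proof (induction T rule: loewner_family_induct)
  case base
  show ?case ..
next
  case (outer R j v)
  have R: "mat e \<preceq> R i" for i
    using loewner_le_trans [OF S outer.hyps] .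
  show ?case
    unfolding mixture_gap_update [where S = R, OF R]
    by (rule order_trans [OF nn_integral_abs_smoothing_le outer.IH])
       (simp_all add: borel_measurable_mixture_gap [OF R] prob_space_normal_density)
qed

text \<open>Finiteness is what allows the inequality between extended integrals to pass to real
  ones. By the triangle inequality and Tonelli the norm is at most twice the mass for covariance
  \<open>mat e\<close>.\<close>

lemma nn_integral_mixture_gap_finite:
  fixes S :: "'n::finite \<Rightarrow> real^'p^'p"
  assumes S: "\<And>i. mat e \<preceq> S i"
  shows "(\<integral>\<^sup>+x. ennreal \<bar>mixture_gap M A S x\<bar> \<partial>lborel) < \<infinity>"
proof -
  interpret M: prob_space M by (rule prob)
  interpret pair_sigma_finite M "lborel :: (real^'p^'n) measure" ..
  let ?F = "\<lambda>\<omega>. indep_normal_density (\<lambda>i. S i + A \<omega>)"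
  let ?K = "\<integral>\<^sup>+x. ennreal \<bar>indep_normal_density (\<lambda>_ :: 'n. mat e :: real^'p^'p) x\<bar> \<partial>lborel"
  have [measurable]: "(\<lambda>(\<omega>, x). ?F \<omega> x) \<in> borel_measurable (M \<Otimes>\<^sub>M lborel)"
    unfolding case_prod_beta by (rule borel_measurable_shifted [OF S]) measurable
  have [measurable]: "(\<lambda>(x, \<omega>). ?F \<omega> x) \<in> borel_measurable (lborel \<Otimes>\<^sub>M M)"
    unfolding case_prod_beta by (rule borel_measurable_shifted [OF S]) measurable
  have [measurable]: "indep_normal_density S \<in> borel_measurable borel"
    by (rule borel_measurable_indep_normal_density_fixed) (rule pos_defI_mat_le [OF e S])
  have "ennreal \<bar>mixture_gap M A S x\<bar> \<le> (\<integral>\<^sup>+\<omega>. ennreal \<bar>?F \<omega> x\<bar> \<partial>M) + ennreal \<bar>indep_normal_density S x\<bar>" for x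
  proof -
    have "ennreal \<bar>LINT \<omega>|M. ?F \<omega> x\<bar> \<le> (\<integral>\<^sup>+\<omega>. ennreal \<bar>?F \<omega> x\<bar> \<partial>M)"
      using integral_norm_bound_ennreal [of M "\<lambda>\<omega>. ?F \<omega> x"]
      by (cases "integrable M (\<lambda>\<omega>. ?F \<omega> x)") (auto simp: not_integrable_integral_eq)
    moreover have "\<bar>mixture_gap M A S x\<bar> \<le> \<bar>LINT \<omega>|M. ?F \<omega> x\<bar> + \<bar>indep_normal_density S x\<bar>"
      unfolding mixture_gap_def by (rule abs_triangle_ineq4)
    then have "ennreal \<bar>mixture_gap M A S x\<bar> \<le> ennreal \<bar>LINT \<omega>|M. ?F \<omega> x\<bar> + ennreal \<bar>indep_normal_density S x\<bar>"
      by (subst ennreal_plus [symmetric]) (simp_all add: ennreal_leI del: ennreal_plus)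
    ultimately show ?thesis
      by (meson add_right_mono order_trans)
  qed
  then have "(\<integral>\<^sup>+x. ennreal \<bar>mixture_gap M A S x\<bar> \<partial>lborel)
      \<le> (\<integral>\<^sup>+x. (\<integral>\<^sup>+\<omega>. ennreal \<bar>?F \<omega> x\<bar> \<partial>M) + ennreal \<bar>indep_normal_density S x\<bar> \<partial>lborel)"
    by (intro nn_integral_mono)
  also have "\<dots> = (\<integral>\<^sup>+x. (\<integral>\<^sup>+\<omega>. ennreal \<bar>?F \<omega> x\<bar> \<partial>M) \<partial>lborel)
      + (\<integral>\<^sup>+x. ennreal \<bar>indep_normal_density S x\<bar> \<partial>lborel)"
    by (rule nn_integral_add) measurable
  also have "(\<integral>\<^sup>+x. (\<integral>\<^sup>+\<omega>. ennreal \<bar>?F \<omega> x\<bar> \<partial>M) \<partial>lborel) = (\<integral>\<^sup>+\<omega>. (\<integral>\<^sup>+x. ennreal \<bar>?F \<omega> x\<bar> \<partial>lborel) \<partial>M)"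
    by (rule Fubini') measurable
  also have "\<dots> \<le> (\<integral>\<^sup>+\<omega>. ?K \<partial>M)"
    by (intro nn_integral_mono nn_integral_indep_normal_density_le [OF e] mat_le_shift S)
  also have "\<dots> = ?K"
    by (simp add: M.emeasure_space_1)
  also have "?K + (\<integral>\<^sup>+x. ennreal \<bar>indep_normal_density S x\<bar> \<partial>lborel) \<le> ?K + ?K"
    by (intro add_left_mono nn_integral_indep_normal_density_le [OF e] S)
  also have "\<dots> < \<infinity>"
    using nn_integral_indep_normal_density_mat_finite [OF e, where 'n = 'n and 'p = 'p] by simp
  finally show ?thesis
    by (simp add: add_right_mono)
qed

end

section \<open>The inequality for the spiked covariance models\<close>

theorem lemma1p1:
  fixes M :: "'w measure"
    and Q :: "'w \<Rightarrow> real^'r^'p"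
    and \<Sigma> \<Sigma>' :: "real^'p^'p"
    and \<delta> :: real
    and f0 f1 g0 g1 :: "real^'p^'n \<Rightarrow> real"
  assumes "CARD('r) \<le> CARD('p)"
    and "0 < \<delta>" "\<delta> < 1"
    and "pos_def \<Sigma>" "pos_def \<Sigma>'"
    and "prob_space M" "Q \<in> borel_measurable M"
    and "uniform_stiefel (distr M borel Q)"
    and "f0 = iid_normal_density \<Sigma>"
    and "f1 = spiked_density M Q \<delta> \<Sigma>"
    and "g0 = iid_normal_density \<Sigma>'"
    and "g1 = spiked_density M Q \<delta> \<Sigma>'"
    and "\<Sigma> \<preceq> \<Sigma>'"
  shows "l1_dist g1 g0 \<le> l1_dist f1 f0"
proof -
  define A where "A = (\<lambda>\<omega>. (\<delta> / (1 - \<delta>)) *\<^sub>R (Q \<omega> ** transpose (Q \<omega>)))"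
  \<comment> \<open>A bound chosen for \<Sigma> serves the larger \<Sigma>' as well.\<close>
  obtain e where e: "0 < e" "mat e \<preceq> \<Sigma>"
    using pos_def_mat_le [OF \<open>pos_def \<Sigma>\<close>] by blast
  have e': "mat e \<preceq> \<Sigma>'"
    using loewner_le_trans [OF e(2) \<open>\<Sigma> \<preceq> \<Sigma>'\<close>] .
  have "(\<lambda>B :: real^'r^'p. (\<delta> / (1 - \<delta>)) *\<^sub>R (B ** transpose B)) \<in> borel_measurable borel"
    unfolding matrix_matrix_mult_def transpose_def
    by (intro borel_measurable_continuous_onI continuous_intros)
  from measurable_compose [OF \<open>Q \<in> borel_measurable M\<close> this]
  have A: "A \<in> borel_measurable M"
    by (simp add: A_def)
  have psd: "pos_semidef (A \<omega>)" for \<omega>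
    unfolding A_def by (rule pos_semidef_gram) (use \<open>0 < \<delta>\<close> \<open>\<delta> < 1\<close> in simp)
  have gap: "spiked_density M Q \<delta> S x - iid_normal_density S x = mixture_gap M A (\<lambda>_. S) x"
    for S and x :: "real^'p^'n"
    by (simp add: spiked_density_def iid_normal_density_def mixture_gap_def indep_normal_density_def A_def)
  have l1: "l1_dist (spiked_density M Q \<delta> S :: real^'p^'n \<Rightarrow> real) (iid_normal_density S) =
      enn2real (\<integral>\<^sup>+x. ennreal \<bar>mixture_gap M A (\<lambda>_ :: 'n. S) x\<bar> \<partial>lborel)" if "mat e \<preceq> S" for S
  proof -
    have [measurable]: "mixture_gap M A (\<lambda>_ :: 'n. S) \<in> borel_measurable borel"
      by (rule borel_measurable_mixture_gap [OF \<open>prob_space M\<close> A psd e(1) that])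
    show ?thesis
      unfolding l1_dist_def gap by (rule integral_eq_nn_integral) auto
  qed
  have "l1_dist g1 g0 = enn2real (\<integral>\<^sup>+x. ennreal \<bar>mixture_gap M A (\<lambda>_ :: 'n. \<Sigma>') x\<bar> \<partial>lborel)"
    unfolding \<open>g0 = _\<close> \<open>g1 = _\<close> by (rule l1 [OF e'])
  also have "\<dots> \<le> enn2real (\<integral>\<^sup>+x. ennreal \<bar>mixture_gap M A (\<lambda>_ :: 'n. \<Sigma>) x\<bar> \<partial>lborel)"
  \<comment> \<open>As \<open>enn2real\<close> sends infinity to 0, it is monotone only below a
    finite bound, so the larger side must be shown finite.\<close>
  proof (rule enn2real_mono)
    show "(\<integral>\<^sup>+x. ennreal \<bar>mixture_gap M A (\<lambda>_ :: 'n. \<Sigma>') x\<bar> \<partial>lborel)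
        \<le> (\<integral>\<^sup>+x. ennreal \<bar>mixture_gap M A (\<lambda>_ :: 'n. \<Sigma>) x\<bar> \<partial>lborel)"
      by (rule nn_integral_mixture_gap_mono [OF \<open>prob_space M\<close> A psd e]) fact
    show "(\<integral>\<^sup>+x. ennreal \<bar>mixture_gap M A (\<lambda>_ :: 'n. \<Sigma>) x\<bar> \<partial>lborel) < top"
      using nn_integral_mixture_gap_finite [OF \<open>prob_space M\<close> A psd e(1), of "\<lambda>_ :: 'n. \<Sigma>"] e(2) by simp
  qed
  also have "\<dots> = l1_dist f1 f0"
    unfolding \<open>f0 = _\<close> \<open>f1 = _\<close> by (rule l1 [OF e(2), symmetric])
  finally show ?thesis .
qed

end
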